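(* Assume the range inclusion $\operatorname{ran}C_{VU}\subseteq\operatorname{ran}C_V$. Then the operator $C_V^\dagger C_{VU}:\mathcal G\to\mathcal H$ is everywhere defined and bounded. Moreover, the affine operator $\gamma^{\mathsf A}_{U|V}\in\mathsf A(\mathcal H;\mathcal G)$ defined by $$\gamma^{\mathsf A}_{U|V}(v):=\mu_U+(C_V^\dagger C_{VU})^*(v-\mu_V)$$ minimizes $\mathcal E_{U|V}(\gamma):=\mathbb E\big[\|U-\gamma\circ V\|_{\mathcal G}^2\big]$ over $\gamma\in\mathsf A(\mathcal H;\mathcal G)$. In particular, $\mathbb E^{\mathsf A}[U|V]=\gamma^{\mathsf A}_{U|V}\circ V$ a.s.
   Context: Standing setup: - $(\Omega,\Sigma,\mathbb P)$ is a probability space and $\mathcal G,\mathcal H$ are separable real Hilbert spaces. - $U\in L^2(\mathbb P;\mathcal G)$ and $V\in L^2(\mathbb P;\mathcal H)$, with Bochner means $\mu_U,\mu_V$. - For $g\in\mathcal G$ and $h\in\mathcal H$, $g\otimes h:\mathcal H\to\mathcal G$ is given by $h'\mapsto\langle h,h'\rangle g$. - $C_{UV}=\mathbb E[(U-\mu_U)\otimes(V-\mu_V)]$, $C_{VU}=C_{UV}^*$ and $C_V=C_{VV}$. - For a bounded linear $A$, $A^\dagger$ denotes its Moore–Penrose pseudo-inverse: the extension of $(A|_{(\ker A)^\perp})^{-1}$ to $\operatorname{ran}A\oplus(\operatorname{ran}A)^\perp$ with kernel $(\operatorname{ran}A)^\perp$. - $\mathsf A(\mathcal H;\mathcal G)$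 is the set of maps $h\mapsto b+Ah$ with $b\in\mathcal G$ and $A$ bounded linear. - $\mathbb E^{\mathsf A}[U|V]$ is the $L^2(\mathbb P;\mathcal G)$-orthogonal projection of $U$ onto the $L^2$-closure of $\{\gamma\circ V:\gamma\in\mathsf A(\mathcal H;\mathcal G)\}$. *)

theory Defs
  imports "HOL-Probability.Probability"
begin

definition L2 :: "'w measure \<Rightarrow> ('w \<Rightarrow> 'g::{real_inner,banach,second_countable_topology}) \<Rightarrow> bool" where
  "L2 M X \<longleftrightarrow> X \<in> borel_measurable M \<and> integrable M (\<lambda>\<omega>. (norm (X \<omega>))\<^sup>2)"

definition bmean :: "'w measure \<Rightarrow> ('w \<Rightarrow> 'g::{real_inner,banach,second_countable_topology}) \<Rightarrow> 'g" where
  "bmean M X = integral\<^sup>L M X"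

text \<open>Cross-covariance operator C_XY = E[(X - mu_X) (x) (Y - mu_Y)] : H -> G,
  applied to h, using (g (x) h) h' = <h, h'> g.\<close>
definition cov :: "'w measure \<Rightarrow> ('w \<Rightarrow> 'g::{real_inner,banach,second_countable_topology})
     \<Rightarrow> ('w \<Rightarrow> 'h::{real_inner,banach,second_countable_topology}) \<Rightarrow> 'h \<Rightarrow> 'g" where
  "cov M X Y = (\<lambda>h'. integral\<^sup>L M (\<lambda>\<omega>. inner (Y \<omega> - bmean M Y) h' *\<^sub>R (X \<omega> - bmean M X)))"

definition orth_compl :: "'a::real_inner set \<Rightarrow> 'a set" where
  "orth_compl S = {x. \<forall>y\<in>S. inner x y = 0}"

text \<open>Moore-Penrose pseudo-inverse: defined on ran A + (ran A)^perp, with kernel (ran A)^perp,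
  inverting A restricted to (ker A)^perp.\<close>
definition pinv_dom :: "('a::real_inner \<Rightarrow> 'b::real_inner) \<Rightarrow> 'b set" where
  "pinv_dom A = {a + b |a b. a \<in> range A \<and> b \<in> orth_compl (range A)}"

definition pinv :: "('a::real_inner \<Rightarrow> 'b::real_inner) \<Rightarrow> 'b \<Rightarrow> 'a" where
  "pinv A y = (THE x. x \<in> orth_compl (A -` {0}) \<and> (\<exists>b\<in>orth_compl (range A). y = A x + b))"

definition adjoint_op :: "('a::real_inner \<Rightarrow> 'b::real_inner) \<Rightarrow> 'b \<Rightarrow> 'a" where
  "adjoint_op A = (THE B. \<forall>x y. inner (A x) y = inner x (B y))"

definition affine_maps :: "('h::real_normed_vector \<Rightarrow> 'g::real_normed_vector) set" where
  "affine_maps = {(\<lambda>h. b + A h) |b A. bounded_linear A}"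

definition mse :: "'w measure \<Rightarrow> ('w \<Rightarrow> 'g::real_normed_vector) \<Rightarrow> ('w \<Rightarrow> 'h) \<Rightarrow> ('h \<Rightarrow> 'g) \<Rightarrow> ennreal" where
  "mse M U V \<gamma> = (\<integral>\<^sup>+ \<omega>. ennreal ((norm (U \<omega> - \<gamma> (V \<omega>)))\<^sup>2) \<partial>M)"

definition affine_L2_closure :: "'w measure \<Rightarrow> ('w \<Rightarrow> 'h::{real_inner,banach,second_countable_topology})
     \<Rightarrow> ('w \<Rightarrow> 'g::{real_inner,banach,second_countable_topology}) set" where
  "affine_L2_closure M V = {W. L2 M W \<and>
     (\<forall>e>0. \<exists>\<gamma>\<in>affine_maps. (\<integral>\<^sup>+ \<omega>. ennreal ((norm (W \<omega> - \<gamma> (V \<omega>)))\<^sup>2) \<partial>M) < ennreal e)}"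

definition is_L2_proj :: "'w measure \<Rightarrow> ('w \<Rightarrow> 'g::{real_inner,banach,second_countable_topology}) set
     \<Rightarrow> ('w \<Rightarrow> 'g) \<Rightarrow> ('w \<Rightarrow> 'g) \<Rightarrow> bool" where
  "is_L2_proj M S U W \<longleftrightarrow> W \<in> S \<and> (\<forall>Z\<in>S. integral\<^sup>L M (\<lambda>\<omega>. inner (U \<omega> - W \<omega>) (Z \<omega>)) = 0)"

end

theory Submission
  imports Defs
begin

text \<open>
  Write \<open>Q = C\<^sub>V\<^sup>\<dagger> C\<^sub>V\<^sub>U\<close> and \<open>R = U - \<gamma>(V)\<close> for the candidate \<open>\<gamma>(v) = \<mu>\<^sub>U + Q\<^sup>*(v - \<mu>\<^sub>V)\<close>. The range inclusion
  gives the normal equation \<open>C\<^sub>V Q = C\<^sub>V\<^sub>U\<close>, which says that every \<open>\<langle>R, g\<rangle>\<close> is uncorrelated with every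
  \<open>\<langle>V, h\<rangle>\<close>. Approximating the identity of the separable space by finite-rank orthogonal projections
  upgrades this to \<open>E \<langle>R, T (V - \<mu>\<^sub>V)\<rangle> = 0\<close> for every bounded linear \<open>T\<close>, so \<open>R\<close> is orthogonal to all
  affine functions of \<open>V\<close> and to their closure; optimality, the projection property and uniqueness
  follow by Pythagoras.
\<close>

section \<open>Hilbert spaces\<close>

text \<open>The parallelogram law makes a sequence of near-minimizers of the distance to
  \<open>x\<close> Cauchy. Its limit \<open>p\<close> attains the infimum \<open>D\<close>, and a
  variation of \<open>p\<close> along a direction of \<open>S\<close> gives orthogonality.\<close>

lemma closed_subspace_projection:
  fixes S :: "'a::{real_inner,banach} set"
  assumes S: "subspace S" "closed S"
  obtains p where "p \<in> S" "\<And>y. y \<in> S \<Longrightarrow> inner (x - p) y = 0"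
proof -
  define D where "D = (INF y\<in>S. (norm (x - y))\<^sup>2)"
  have ne: "S \<noteq> {}" using S subspace_0 by auto
  have bdd: "bdd_below ((\<lambda>y. (norm (x - y))\<^sup>2) ` S)"
    by (intro bdd_belowI[of _ 0]) auto
  have D_le: "D \<le> (norm (x - y))\<^sup>2" if "y \<in> S" for y
    unfolding D_def using that bdd by (rule cINF_lower[rotated])
  have "\<exists>y\<in>S. (norm (x - y))\<^sup>2 < D + e" if "e > 0" for e
    using cINF_less_iff[OF ne bdd, of "D + e"] that by (simp add: D_def)
  then have "\<exists>y\<in>S. (norm (x - y))\<^sup>2 < D + inverse (real (Suc n))" for n
    by simp
  then obtain y where y: "\<And>n. y n \<in> S" "\<And>n. (norm (x - y n))\<^sup>2 < D + inverse (real (Suc n))"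
    by metis
  have diff: "(norm (y m - y n))\<^sup>2 \<le> 2 * inverse (real (Suc m)) + 2 * inverse (real (Suc n))" for m n
  proof -
    \<comment> \<open>The midpoint stays in \<open>S\<close>, so its squared distance is at least
      \<open>D\<close>; by the parallelogram law this forces two near-minimizers to be
      close.\<close>
    have "(1/2) *\<^sub>R (y m + y n) \<in> S"
      using S y by (simp add: subspace_add subspace_scale)
    then have "D \<le> (norm (x - (1/2) *\<^sub>R (y m + y n)))\<^sup>2" by (rule D_le)
    moreover have "(norm (y m - y n))\<^sup>2 =
        2 * (norm (x - y m))\<^sup>2 + 2 * (norm (x - y n))\<^sup>2 - 4 * (norm (x - (1/2) *\<^sub>R (y m + y n)))\<^sup>2"
      unfolding power2_norm_eq_inner by (simp add: algebra_simps inner_commute)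
    ultimately show ?thesis using y(2)[of m] y(2)[of n] by linarith
  qed
  have "Cauchy y"
  proof (rule metric_CauchyI)
    fix e :: real assume e: "e > 0"
    then have "e\<^sup>2 / 4 > 0" by simp
    then obtain N where N: "inverse (real (Suc N)) < e\<^sup>2 / 4"
      using reals_Archimedean by blast
    show "\<exists>N. \<forall>m\<ge>N. \<forall>n\<ge>N. dist (y m) (y n) < e"
    proof (intro exI allI impI)
      fix m n assume "N \<le> m" "N \<le> n"
      then have "inverse (real (Suc m)) \<le> inverse (real (Suc N))"
        "inverse (real (Suc n)) \<le> inverse (real (Suc N))"
        by (auto intro!: le_imp_inverse_le)
      then have "(norm (y m - y n))\<^sup>2 < e\<^sup>2"
        using diff[of m n] N by linarith
      then show "dist (y m) (y n) < e"
        using e by (simp add: dist_norm power2_less_imp_less)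
    qed
  qed
  then obtain p where p: "y \<longlonglongrightarrow> p"
    using Cauchy_convergent convergent_def by blast
  have pS: "p \<in> S"
    using closed_sequentially[OF S(2)] y(1) p by blast
  have "(\<lambda>n. D + inverse (real (Suc n))) \<longlonglongrightarrow> D + 0"
    by (intro tendsto_intros LIMSEQ_inverse_real_of_nat)
  moreover have "(\<lambda>n. (norm (x - y n))\<^sup>2) \<longlonglongrightarrow> (norm (x - p))\<^sup>2"
    by (intro tendsto_intros p)
  ultimately have "(norm (x - p))\<^sup>2 \<le> D + 0"
    using y(2) by (intro LIMSEQ_le[of _ _ _ "D + 0"]) (auto intro: less_imp_le)
  then have pD: "(norm (x - p))\<^sup>2 \<le> D" by simp
  have "inner (x - p) z = 0" if z: "z \<in> S" for z
  proof (cases "z = 0")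
    case False
    \<comment> \<open>This \<open>t\<close> minimizes the quadratic
      \<open>norm (x - p - t z)\<close> squared. Minimality of \<open>p\<close> leaves no room for
      the decrease that it would produce.\<close>
    define t where "t = inner (x - p) z / inner z z"
    have "p + t *\<^sub>R z \<in> S"
      using S pS z by (simp add: subspace_add subspace_scale)
    then have "(norm (x - p))\<^sup>2 \<le> (norm (x - p - t *\<^sub>R z))\<^sup>2"
      using pD D_le[of "p + t *\<^sub>R z"] by (metis diff_diff_eq order_trans)
    also have "\<dots> = (norm (x - p))\<^sup>2 - 2 * t * inner (x - p) z + t * t * inner z z"
      unfolding power2_norm_eq_inner by (simp add: inner_diff inner_commute algebra_simps)
    also have "t * t * inner z z = t * inner (x - p) z"
      using False by (simp add: t_def)
    finally have "t * inner (x - p) z \<le> 0" by simp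
    then have "(inner (x - p) z)\<^sup>2 / inner z z \<le> 0"
      by (simp add: t_def power2_eq_square)
    then have "(inner (x - p) z)\<^sup>2 \<le> 0"
      using inner_gt_zero_iff[of z] False by (simp add: divide_le_0_iff del: inner_gt_zero_iff)
    then show ?thesis by simp
  qed simp
  then show thesis using that pS by blast
qed

text \<open>The kernel of a nonzero functional has codimension one. A vector \<open>q\<close>
  orthogonal to the kernel therefore determines the functional up to scale.\<close>

lemma riesz_representation:
  fixes f :: "'a::{real_inner,banach} \<Rightarrow> real"
  assumes f: "bounded_linear f"
  obtains z where "\<And>x. f x = inner x z"
proof (cases "\<forall>x. f x = 0")
  case True
  then show thesis using that[of 0] by simp
next
  case False
  interpret bounded_linear f by fact
  obtain x0 where x0: "f x0 \<noteq> 0" using False by blast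
  let ?K = "f -` {0}"
  have "subspace ?K" by (auto simp: subspace_def add scaleR zero)
  moreover have "closed ?K"
    by (intro closed_vimage continuous_on linear_continuous_on f) auto
  ultimately obtain p where p: "p \<in> ?K" "\<And>y. y \<in> ?K \<Longrightarrow> inner (x0 - p) y = 0"
    using closed_subspace_projection by blast
  define q where "q = x0 - p"
  have fq: "f q \<noteq> 0" using x0 p by (simp add: q_def diff)
  then have qq: "inner q q \<noteq> 0" using zero by auto
  have "f x = inner x ((f q / inner q q) *\<^sub>R q)" for x
  proof -
    have "f (x - (f x / f q) *\<^sub>R q) = 0" using fq by (simp add: diff scaleR)
    then have "inner q (x - (f x / f q) *\<^sub>R q) = 0" using p by (simp add: q_def)
    then have "inner q x = f x / f q * inner q q" by (simp add: inner_diff_right)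
    then show ?thesis using fq qq by (simp add: inner_commute)
  qed
  then show thesis by (rule that)
qed

lemma adjoint_op_eqI:
  assumes "\<And>x y. inner (A x) y = inner x (B y)"
  shows "adjoint_op A = B"
  unfolding adjoint_op_def
proof (rule the_equality)
  fix B' assume B': "\<forall>x y. inner (A x) y = inner x (B' y)"
  show "B' = B"
  proof
    fix y
    have "inner x (B' y - B y) = 0" for x
      using B' assms by (simp add: inner_diff_right)
    then show "B' y = B y" using inner_eq_zero_iff[of "B' y - B y"] by simp
  qed
qed (use assms in blast)

text \<open>Riesz representation of each functional \<open>x \<mapsto> inner (A x) y\<close> gives
  existence, which makes the description in \<open>adjoint_op\<close> meaningful. Testing at
  \<open>x = B y\<close> carries the bound of \<open>A\<close> over to the adjoint.\<close>

lemma adjoint_op_bounded_linear: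
  fixes A :: "'a::{real_inner,banach} \<Rightarrow> 'b::real_inner"
  assumes A: "bounded_linear A"
  shows "bounded_linear (adjoint_op A)" and "inner (A x) y = inner x (adjoint_op A y)"
proof -
  interpret bounded_linear A by fact
  have "\<exists>z. \<forall>x. inner (A x) y = inner x z" for y
    using riesz_representation[OF bounded_linear_compose[OF bounded_linear_inner_left A], of y] by metis
  then obtain B where B: "\<And>x y. inner (A x) y = inner x (B y)" by metis
  have eq: "adjoint_op A = B" using B by (rule adjoint_op_eqI)
  obtain K where K: "K \<ge> 0" "\<And>x. norm (A x) \<le> norm x * K" using nonneg_bounded by blast
  have eqI: "u = v" if "\<And>x. inner x u = inner x v" for u v :: 'a
    using that[of "u - v"] inner_eq_zero_iff[of "u - v"] by (simp add: inner_diff_right)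
  have "bounded_linear B"
  proof (rule bounded_linear_intro)
    show "B (x + y) = B x + B y" for x y
      by (rule eqI) (simp add: inner_add_right flip: B)
    show "B (r *\<^sub>R x) = r *\<^sub>R B x" for r x
      by (rule eqI) (simp flip: B)
    show "norm (B y) \<le> norm y * K" for y
    proof (cases "B y = 0")
      case True
      then show ?thesis using K(1) by simp
    next
      case False
      have "norm (B y) * norm (B y) = inner (A (B y)) y"
        by (simp add: B flip: power2_norm_eq_inner power2_eq_square)
      also have "\<dots> \<le> norm (A (B y)) * norm y" by (rule norm_cauchy_schwarz)
      also have "\<dots> \<le> (norm (B y) * K) * norm y" by (intro mult_right_mono K) auto
      finally show ?thesis using False by (simp add: mult.assoc mult.commute)
    qed
  qed
  then show "bounded_linear (adjoint_op A)" "inner (A x) y = inner x (adjoint_op A y)"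
    using B eq by auto
qed

text \<open>Uniform boundedness principle for the functionals \<open>inner _ s\<close>: the closed
  sets \<open>F n\<close> cover the space, so by Baire one of them contains a ball, and on that ball
  the bound is uniform in \<open>s\<close>.\<close>

lemma weakly_bounded_imp_bounded:
  fixes S :: "'a::{real_inner,banach} set"
  assumes S: "\<And>x. bdd_above ((\<lambda>s. \<bar>inner x s\<bar>) ` S)"
  shows "bounded S"
proof -
  define F where "F n = {x. \<forall>s\<in>S. \<bar>inner x s\<bar> \<le> real n}" for n
  have closed: "closed (F n)" for n
  proof -
    have "F n = (\<Inter>s\<in>S. {x. \<bar>inner x s\<bar> \<le> real n})" by (auto simp: F_def)
    moreover have "closed {x. \<bar>inner x s\<bar> \<le> real n}" for s :: 'a
      by (intro closed_Collect_le continuous_intros)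
    ultimately show ?thesis by auto
  qed
  have "(\<Union>n. F n) = UNIV"
  proof (intro equalityI subset_UNIV subsetI)
    fix x
    obtain b where b: "\<And>s. s \<in> S \<Longrightarrow> \<bar>inner x s\<bar> \<le> b"
      using S[of x] by (auto simp: bdd_above_def)
    obtain n where "b \<le> real n" using real_arch_simple by blast
    then have "x \<in> F n" unfolding F_def using b by force
    then show "x \<in> (\<Union>n. F n)" by blast
  qed
  moreover have "interior (\<Union>n. F n) = {}" if "\<And>n. interior (F n) = {}"
    using Met_TC.metric_Baire_category_alt[of "range F"] closed that
    by (auto simp: complete_UNIV)
  ultimately obtain n where "interior (F n) \<noteq> {}" by fastforce
  then obtain x r where r: "r > 0" "cball x r \<subseteq> F n"
    by (metis all_not_in_conv mem_interior_cball)
  have "norm s \<le> 2 * real n / r" if s: "s \<in> S" for s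
  proof (cases "s = 0")
    case False
    \<comment> \<open>A step of length \<open>r\<close> from the centre towards \<open>s\<close>:
      both ends lie in \<open>F n\<close>, and the pairing with \<open>s\<close> changes by exactly
      \<open>r * norm s\<close>.\<close>
    define y where "y = (r / norm s) *\<^sub>R s"
    have "norm y = r" using r False by (simp add: y_def)
    then have "x \<in> F n" "x + y \<in> F n" using r by (auto simp: dist_norm)
    then have "\<bar>inner x s\<bar> \<le> n" "\<bar>inner (x + y) s\<bar> \<le> n" using s by (auto simp: F_def)
    then have "inner y s \<le> 2 * real n" by (simp add: inner_add_left)
    moreover have "inner y s = r * norm s"
      using False by (simp add: y_def dot_square_norm power2_eq_square)
    ultimately show ?thesis using r by (simp add: field_simps)
  qed (use r in simp)
  then show ?thesis by (auto simp: bounded_iff)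
qed

text \<open>The sum is the orthogonal projection onto the span of \<open>D\<close>, in an orthogonal
  but not normalized spanning set \<open>C\<close>. Pythagoras gives both the contraction (compare
  with 0) and the best approximation (compare with \<open>d\<close>).\<close>

lemma finite_rank_orthogonal_projection:
  fixes D :: "'a::real_inner set"
  assumes "finite D"
  obtains C where "finite C" "\<And>x. norm (\<Sum>b\<in>C. inner x b *\<^sub>R (b /\<^sub>R inner b b)) \<le> norm x"
    "\<And>x d. d \<in> D \<Longrightarrow> norm (x - (\<Sum>b\<in>C. inner x b *\<^sub>R (b /\<^sub>R inner b b))) \<le> norm (x - d)"
proof -
  obtain C where C: "finite C" "span C = span D" "pairwise orthogonal C"
    using basis_orthogonal[OF assms] by blast
  define P where "P x = (\<Sum>b\<in>C. inner x b *\<^sub>R (b /\<^sub>R inner b b))" for x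
  have span: "P x \<in> span C" for x
    unfolding P_def by (intro span_sum span_scale span_base)
  have "orthogonal (x - P x) c" if c: "c \<in> C" for x c
  proof -
    have "inner (P x) c = (\<Sum>b\<in>C. if b = c then inner x c else 0)"
      unfolding P_def inner_sum_left
    proof (intro sum.cong refl)
      fix b assume "b \<in> C"
      then show "inner (inner x b *\<^sub>R (b /\<^sub>R inner b b)) c = (if b = c then inner x c else 0)"
        \<comment> \<open>\<open>C\<close> may contain the zero vector; its summand vanishes, since
          division by zero yields zero.\<close>
        using C(3) c by (cases "c = 0") (auto simp: pairwise_def orthogonal_def)
    qed
    then show ?thesis using C(1) c by (simp add: orthogonal_def inner_diff_left)
  qed
  then have orth: "inner (x - P x) y = 0" if "y \<in> span C" for x y
    using orthogonal_to_span[OF that] by (simp add: orthogonal_def)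
  have pyth: "(norm (x - y))\<^sup>2 = (norm (x - P x))\<^sup>2 + (norm (P x - y))\<^sup>2" if "y \<in> span C" for x y
  proof -
    have "inner (x - P x) (P x - y) = 0" using that span by (intro orth span_diff)
    moreover from this have "inner (P x - y) (x - P x) = 0" by (simp only: inner_commute)
    moreover have "x - y = (x - P x) + (P x - y)" by simp
    ultimately show ?thesis
      unfolding power2_norm_eq_inner by (simp only: inner_add add_0 add_0_right)
  qed
  show thesis
  proof (rule that[of C, folded P_def])
    show "norm (P x) \<le> norm x" for x
      by (rule power2_le_imp_le) (use pyth[of 0 x] in \<open>auto simp: span_zero\<close>)
    show "norm (x - P x) \<le> norm (x - d)" if "d \<in> D" for x d
      by (rule power2_le_imp_le) (use pyth[of d x] C(2) span_base[OF that] in auto)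
  qed (use C in auto)
qed

text \<open>\<open>P n\<close> projects onto the span of the first members of a dense sequence, so
  it is at least as close to \<open>x\<close> as any of them. The explicit finite sum lets integrals
  split into scalar ones, and the contraction supplies a dominating function.\<close>

lemma finite_rank_approximate_identity:
  obtains P :: "nat \<Rightarrow> 'a::{real_inner,second_countable_topology} \<Rightarrow> 'a" and C e where
    "\<And>n. finite (C n)" "\<And>n x. P n x = (\<Sum>b\<in>C n. inner x b *\<^sub>R e b)"
    "\<And>n x. norm (P n x) \<le> norm x" "\<And>x. (\<lambda>n. P n x) \<longlonglongrightarrow> x"
proof -
  obtain D :: "'a set" where D: "countable D" "\<And>X. open X \<Longrightarrow> X \<noteq> {} \<Longrightarrow> \<exists>d\<in>D. d \<in> X"
    by (erule countable_dense_setE)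
  define d where "d = from_nat_into D"
  define Q where "Q C x = (\<Sum>b\<in>C. inner x b *\<^sub>R (b /\<^sub>R inner b b))" for C and x :: 'a
  have "\<exists>C. finite C \<and> (\<forall>x. norm (Q C x) \<le> norm x \<and> (\<forall>k\<le>n. norm (x - Q C x) \<le> norm (x - d k)))" for n
    by (rule finite_rank_orthogonal_projection[of "d ` {..n}"]) (auto simp: Q_def)
  then obtain C where C: "\<And>n. finite (C n)"
    "\<And>n x. norm (Q (C n) x) \<le> norm x" "\<And>n x k. k \<le> n \<Longrightarrow> norm (x - Q (C n) x) \<le> norm (x - d k)"
    by metis
  have "(\<lambda>n. Q (C n) x) \<longlonglongrightarrow> x" for x
  proof (rule metric_LIMSEQ_I)
    fix r :: real assume "r > 0"
    then obtain k where "dist x (d k) < r"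
      using D(2)[of "ball x r"] from_nat_into_surj[OF D(1)] by (auto simp: d_def)
    then have "\<forall>n\<ge>k. dist (Q (C n) x) x < r"
      using C(3)[of k _ x] by (metis dist_commute dist_norm le_less_trans)
    then show "\<exists>k. \<forall>n\<ge>k. dist (Q (C n) x) x < r" by blast
  qed
  with C show thesis by (intro that[of C "\<lambda>n. Q (C n)" "\<lambda>b. b /\<^sub>R inner b b"]) (auto simp: Q_def)
qed

section \<open>Pseudo-inverses\<close>

text \<open>Symmetry moves \<open>A\<close> across the inner product. As a consequence the kernel is
  an orthogonal complement, hence closed, without any appeal to continuity of
  \<open>A\<close>.\<close>

lemma orth_compl_range_symmetric:
  assumes "\<And>x y. inner (A x) y = inner x (A y)"
  shows "orth_compl (range A) = A -` {0}"
proof (intro equalityI subsetI)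
  fix x assume "x \<in> orth_compl (range A)"
  then have "inner x (A (A x)) = 0" by (simp add: orth_compl_def)
  then have "inner (A x) (A x) = 0" using assms[of x "A x"] by simp
  then show "x \<in> A -` {0}" by simp
next
  fix x assume "x \<in> A -` {0}"
  then show "x \<in> orth_compl (range A)" by (simp add: orth_compl_def flip: assms)
qed

lemma closed_orth_compl: "closed (orth_compl S)"
proof -
  have "orth_compl S = (\<Inter>y\<in>S. {x. inner x y = 0})" by (auto simp: orth_compl_def)
  moreover have "closed {x. inner x y = 0}" for y :: 'a
    by (intro closed_Collect_eq continuous_intros)
  ultimately show ?thesis by auto
qed

lemma subspace_orth_compl: "subspace (orth_compl S)"
  by (auto simp: subspace_def orth_compl_def inner_add_left)

lemma subspace_closure:
  fixes S :: "'a::real_normed_vector set"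
  assumes S: "subspace S" shows "subspace (closure S)"
proof (rule subspaceI)
  show "0 \<in> closure S" using subspace_0[OF S] closure_subset by blast
next
  fix x y assume "x \<in> closure S" "y \<in> closure S"
  then obtain u v where "\<And>n. u n \<in> S" "u \<longlonglongrightarrow> x" "\<And>n. v n \<in> S" "v \<longlonglongrightarrow> y"
    unfolding closure_sequential by blast
  then have "(\<lambda>n. u n + v n) \<longlonglongrightarrow> x + y" "\<And>n. u n + v n \<in> S"
    using subspace_add[OF S] by (auto intro: tendsto_add)
  then show "x + y \<in> closure S" unfolding closure_sequential by (intro exI[of _ "\<lambda>n. u n + v n"]) blast
next
  fix c :: real and x assume "x \<in> closure S"
  then obtain u where "\<And>n. u n \<in> S" "u \<longlonglongrightarrow> x"
    unfolding closure_sequential by blast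
  then have "(\<lambda>n. c *\<^sub>R u n) \<longlonglongrightarrow> c *\<^sub>R x" "\<And>n. c *\<^sub>R u n \<in> S"
    using subspace_scale[OF S] by (auto intro: tendsto_intros)
  then show "c *\<^sub>R x \<in> closure S" unfolding closure_sequential by (intro exI[of _ "\<lambda>n. c *\<^sub>R u n"]) blast
qed

text \<open>The residual of projecting \<open>x\<close> onto the closure of \<open>S\<close> is
  orthogonal both to \<open>x\<close> and to the projection, hence to itself.\<close>

lemma orth_compl_orth_compl_subset_closure:
  fixes S :: "'a::{real_inner,banach} set"
  assumes "subspace S"
  shows "orth_compl (orth_compl S) \<subseteq> closure S"
proof
  fix x assume x: "x \<in> orth_compl (orth_compl S)"
  obtain p where p: "p \<in> closure S" "\<And>y. y \<in> closure S \<Longrightarrow> inner (x - p) y = 0"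
    using closed_subspace_projection[of "closure S" x] subspace_closure[OF assms] by auto
  then have q: "x - p \<in> orth_compl S"
    using closure_subset[of S] by (auto simp: orth_compl_def)
  have "inner (x - p) (x - p) = inner x (x - p) - inner (x - p) p"
    by (simp add: inner_diff_left inner_diff_right inner_commute)
  also have "\<dots> = 0" using x q p by (simp add: orth_compl_def)
  finally show "x \<in> closure S" using p(1) by simp
qed

text \<open>Two candidates in the description of \<open>pinv\<close> differ by a vector lying in the
  kernel and in its complement.\<close>

lemma pinv_eqI:
  assumes "linear A" "x \<in> orth_compl (A -` {0})"
  shows "pinv A (A x) = x"
  unfolding pinv_def
proof (rule the_equality)
  have "0 \<in> orth_compl (range A)" by (simp add: orth_compl_def)
  then show "x \<in> orth_compl (A -` {0}) \<and> (\<exists>b\<in>orth_compl (range A). A x = A x + b)"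
    using assms by force
next
  interpret linear A by fact
  fix z assume z: "z \<in> orth_compl (A -` {0}) \<and> (\<exists>b\<in>orth_compl (range A). A x = A z + b)"
  then obtain b where b: "b \<in> orth_compl (range A)" "A x = A z + b" by blast
  \<comment> \<open>So \<open>b\<close> lies in the range as well as in its complement, and
    vanishes.\<close>
  then have "b = A (x - z)" by (simp add: diff)
  with b(1) have "inner b b = 0" by (simp add: orth_compl_def)
  then have "x - z \<in> A -` {0}" using b(2) by (simp add: diff)
  moreover have "x - z \<in> orth_compl (A -` {0})"
    using assms(2) z subspace_diff[OF subspace_orth_compl] by blast
  ultimately have "inner (x - z) (x - z) = 0" by (simp only: orth_compl_def mem_Collect_eq)
  then show "z = x" by simp
qed

text \<open>Subtracting from a preimage its projection onto the closed kernel gives a preimage in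
  the complement of the kernel, which is the value of the pseudo-inverse.\<close>

lemma pinv_range:
  fixes A :: "'a::{real_inner,banach} \<Rightarrow> 'b::real_inner"
  assumes "linear A" "closed (A -` {0})" "y \<in> range A"
  shows "pinv A y \<in> orth_compl (A -` {0})" and "A (pinv A y) = y"
proof -
  interpret linear A by fact
  obtain x where x: "y = A x" using assms by blast
  have "subspace (A -` {0})" by (auto simp: subspace_def add scale zero)
  then obtain p where p: "p \<in> A -` {0}" "\<And>y. y \<in> A -` {0} \<Longrightarrow> inner (x - p) y = 0"
    using closed_subspace_projection[OF _ assms(2)] by blast
  then have xp: "x - p \<in> orth_compl (A -` {0})" "A (x - p) = y"
    using x by (auto simp: orth_compl_def diff)
  then have "pinv A y = x - p" using pinv_eqI[OF assms(1)] by metis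
  with xp show "pinv A y \<in> orth_compl (A -` {0})" "A (pinv A y) = y" by auto
qed

text \<open>The values of \<open>A\<^sup>\<dagger>C\<close> lie in the closure of the range of \<open>A\<close>, and \<open>\<langle>A\<^sup>\<dagger>C g, A h\<rangle> = \<langle>g, D h\<rangle>\<close>.
  Hence the vectors \<open>D h\<close> with \<open>\<parallel>A h\<parallel> \<le> 1\<close> are weakly bounded, and the uniform bound they obey
  bounds \<open>A\<^sup>\<dagger>C\<close>.\<close>
lemma bounded_linear_pinv_comp:
  fixes A :: "'h::{real_inner,banach} \<Rightarrow> 'h" and C :: "'g::{real_inner,banach} \<Rightarrow> 'h"
  assumes A: "linear A" and symm: "\<And>x y. inner (A x) y = inner x (A y)"
    and C: "linear C" and adj: "\<And>g h. inner (C g) h = inner g (D h)"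
    and range: "range C \<subseteq> range A"
  shows "bounded_linear (\<lambda>g. pinv A (C g))"
proof -
  interpret A: linear A by fact
  interpret C: linear C by fact
  define Q where "Q g = pinv A (C g)" for g
  have ker: "A -` {0} = orth_compl (range A)"
    using orth_compl_range_symmetric[of A] symm by simp
  then have "closed (A -` {0})" by (simp add: closed_orth_compl)
  with A have Q: "Q g \<in> orth_compl (A -` {0})" "A (Q g) = C g" for g
    unfolding Q_def using pinv_range[of A "C g"] range by blast+
  have QI: "Q g = x" if "x \<in> orth_compl (A -` {0})" "A x = C g" for g x
    using pinv_eqI[OF A that(1)] that(2) by (simp add: Q_def)
  have pair: "inner (Q g) (A h) = inner g (D h)" for g h
    using Q(2) by (simp flip: symm adj)
  have "bounded (D ` {h. norm (A h) \<le> 1})"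
  proof (rule weakly_bounded_imp_bounded)
    fix g
    have "\<bar>inner g (D h)\<bar> \<le> norm (Q g)" if "norm (A h) \<le> 1" for h
    proof -
      have "\<bar>inner (Q g) (A h)\<bar> \<le> norm (Q g) * norm (A h)" by (rule Cauchy_Schwarz_ineq2)
      also have "\<dots> \<le> norm (Q g)" using that by (simp add: mult_left_le)
      finally show ?thesis by (simp add: pair)
    qed
    then show "bdd_above ((\<lambda>s. \<bar>inner g s\<bar>) ` D ` {h. norm (A h) \<le> 1})"
      by (intro bdd_aboveI[of _ "norm (Q g)"]) auto
  qed
  then obtain K where K: "\<And>h. norm (A h) \<le> 1 \<Longrightarrow> norm (D h) \<le> K"
    by (auto simp: bounded_iff)
  have on_range: "inner (Q g) y \<le> norm g * K * norm y" if "y \<in> range A" for g y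
  proof (cases "y = 0")
    case False
    obtain h where h: "y = A h" using \<open>y \<in> range A\<close> by blast
    \<comment> \<open>Rescaled so that \<open>A h'\<close> is a unit vector, which puts
      \<open>D h'\<close> in the set bounded by \<open>K\<close>.\<close>
    define h' where "h' = h /\<^sub>R norm y"
    have h': "A h' = y /\<^sub>R norm y" by (simp add: h'_def h A.scale)
    then have "norm (D h') \<le> K" using False by (intro K) simp
    have "inner (Q g) (y /\<^sub>R norm y) = inner g (D h')" by (simp only: pair flip: h')
    also have "\<dots> \<le> norm g * norm (D h')" by (rule norm_cauchy_schwarz)
    also have "\<dots> \<le> norm g * K" using \<open>norm (D h') \<le> K\<close> by (intro mult_left_mono) auto
    finally show ?thesis using False by (simp add: field_simps)
  qed simp
  \<comment> \<open>The estimate is a closed condition on \<open>y\<close>, so it extends from the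
    range to its closure. That closure contains \<open>Q g\<close>, and taking
    \<open>y = Q g\<close> bounds its norm.\<close>
  have "closure (range A) \<subseteq> {y. inner (Q g) y \<le> norm g * K * norm y}" for g
    using on_range by (intro closure_minimal closed_Collect_le continuous_intros) auto
  moreover have "Q g \<in> closure (range A)" for g
    using Q(1)[of g] orth_compl_orth_compl_subset_closure[OF linear_subspace_image[OF A subspace_UNIV]]
    by (auto simp: ker)
  ultimately have QQ: "inner (Q g) (Q g) \<le> norm g * K * norm (Q g)" for g
    by blast
  have K0: "K \<ge> 0" using K[of 0] order_trans[OF norm_ge_zero] by (simp add: A.zero)
  have "bounded_linear Q"
  proof (rule bounded_linear_intro)
    \<comment> \<open>Linearity comes from uniqueness: the right-hand side is also a preimage in the
      complement of the kernel.\<close>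
    show "Q (x + y) = Q x + Q y" for x y
      by (rule QI) (simp_all add: subspace_add[OF subspace_orth_compl] Q A.add C.add)
    show "Q (r *\<^sub>R x) = r *\<^sub>R Q x" for r x
      by (rule QI) (simp_all add: subspace_scale[OF subspace_orth_compl] Q A.scale C.scale)
    show "norm (Q g) \<le> norm g * K" for g
    proof (cases "Q g = 0")
      case False
      then show ?thesis
        using QQ[of g] by (simp add: dot_square_norm power2_eq_square)
    qed (use K0 in simp)
  qed
  then show ?thesis by (simp add: Q_def[abs_def])
qed

section \<open>Square-integrable random vectors\<close>

lemma L2_diff:
  assumes "L2 M X" "L2 M Y" shows "L2 M (\<lambda>\<omega>. X \<omega> - Y \<omega>)"
proof -
  have [measurable]: "X \<in> borel_measurable M" "Y \<in> borel_measurable M"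
    using assms by (auto simp: L2_def)
  have "(norm (a - b))\<^sup>2 \<le> 2 * (norm a)\<^sup>2 + 2 * (norm b)\<^sup>2" for a b :: 'b
  proof -
    have "(norm (a - b))\<^sup>2 \<le> (norm a + norm b)\<^sup>2" by (intro power_mono norm_triangle_ineq4) auto
    also have "\<dots> \<le> 2 * (norm a)\<^sup>2 + 2 * (norm b)\<^sup>2"
      using sum_squares_bound[of "norm a" "norm b"] by (simp add: power2_sum)
    finally show ?thesis .
  qed
  moreover have "integrable M (\<lambda>\<omega>. 2 * (norm (X \<omega>))\<^sup>2 + 2 * (norm (Y \<omega>))\<^sup>2)"
    using assms by (auto simp: L2_def)
  ultimately have "integrable M (\<lambda>\<omega>. (norm (X \<omega> - Y \<omega>))\<^sup>2)"
    by (elim Bochner_Integration.integrable_bound) auto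
  then show ?thesis by (simp add: L2_def)
qed

lemma L2_bounded_linear:
  assumes T: "bounded_linear T" and X: "L2 M X" shows "L2 M (\<lambda>\<omega>. T (X \<omega>))"
proof -
  have [measurable]: "X \<in> borel_measurable M" using X by (auto simp: L2_def)
  have [measurable]: "(\<lambda>\<omega>. T (X \<omega>)) \<in> borel_measurable M"
    by (intro borel_measurable_continuous_on[of T] linear_continuous_on T) simp
  obtain K where K: "\<And>x. norm (T x) \<le> norm x * K"
    using bounded_linear.bounded[OF T] by blast
  have "(norm (T x))\<^sup>2 \<le> K\<^sup>2 * (norm x)\<^sup>2" for x
    using power_mono[OF K[of x], of 2] by (simp add: power_mult_distrib mult.commute)
  moreover have "integrable M (\<lambda>\<omega>. K\<^sup>2 * (norm (X \<omega>))\<^sup>2)"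
    using X by (auto simp: L2_def)
  ultimately have "integrable M (\<lambda>\<omega>. (norm (T (X \<omega>)))\<^sup>2)"
    by (elim Bochner_Integration.integrable_bound) auto
  then show ?thesis by (simp add: L2_def)
qed

lemma (in finite_measure) L2_const: "L2 M (\<lambda>_. c)"
  by (simp add: L2_def)

lemma (in finite_measure) L2_imp_integrable:
  assumes "L2 M X" shows "integrable M X"
proof (rule Bochner_Integration.integrable_bound)
  show "integrable M (\<lambda>\<omega>. 1 + (norm (X \<omega>))\<^sup>2)" using assms by (simp add: L2_def)
  have "norm x \<le> 1 + (norm x)\<^sup>2" for x :: 'b
    using sum_squares_bound[of "norm x" 1] norm_ge_zero[of x] by (simp, linarith)
  then show "AE \<omega> in M. norm (X \<omega>) \<le> norm (1 + (norm (X \<omega>))\<^sup>2)" by simp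
qed (use assms in \<open>simp add: L2_def\<close>)

lemma norm_mult_le_sum_squares: "norm x * norm y \<le> (norm x)\<^sup>2 + (norm y)\<^sup>2"
proof -
  have "0 \<le> norm x * norm y" by simp
  then show ?thesis using sum_squares_bound[of "norm x" "norm y"] by linarith
qed

lemma L2_integrable_inner:
  assumes "L2 M X" "L2 M Y" shows "integrable M (\<lambda>\<omega>. inner (X \<omega>) (Y \<omega>))"
proof (rule Bochner_Integration.integrable_bound)
  show "integrable M (\<lambda>\<omega>. (norm (X \<omega>))\<^sup>2 + (norm (Y \<omega>))\<^sup>2)" using assms by (simp add: L2_def)
  show "AE \<omega> in M. norm (inner (X \<omega>) (Y \<omega>)) \<le> norm ((norm (X \<omega>))\<^sup>2 + (norm (Y \<omega>))\<^sup>2)"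
    using order_trans[OF Cauchy_Schwarz_ineq2 norm_mult_le_sum_squares] by auto
qed (use assms in \<open>auto simp: L2_def intro: borel_measurable_inner\<close>)

text \<open>Ensures that the Bochner integral defining \<open>cov\<close> is that of an integrable
  function, rather than the default value 0.\<close>

lemma L2_integrable_inner_scaleR:
  assumes "L2 M X" "L2 M Y" shows "integrable M (\<lambda>\<omega>. inner (Y \<omega>) h *\<^sub>R X \<omega>)"
proof (rule Bochner_Integration.integrable_bound)
  show "integrable M (\<lambda>\<omega>. norm h * ((norm (Y \<omega>))\<^sup>2 + (norm (X \<omega>))\<^sup>2))" using assms by (simp add: L2_def)
  have "norm (inner y h *\<^sub>R x) \<le> norm h * ((norm y)\<^sup>2 + (norm x)\<^sup>2)" for x :: 'b and y :: 'c
  proof -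
    have "norm (inner y h *\<^sub>R x) \<le> (norm y * norm h) * norm x"
      by (simp add: Cauchy_Schwarz_ineq2 mult_right_mono)
    also have "\<dots> = norm h * (norm y * norm x)" by simp
    also have "\<dots> \<le> norm h * ((norm y)\<^sup>2 + (norm x)\<^sup>2)"
      by (intro mult_left_mono norm_mult_le_sum_squares) auto
    finally show ?thesis .
  qed
  then show "AE \<omega> in M. norm (inner (Y \<omega>) h *\<^sub>R X \<omega>) \<le> norm (norm h * ((norm (Y \<omega>))\<^sup>2 + (norm (X \<omega>))\<^sup>2))"
    by auto
  have [measurable]: "X \<in> borel_measurable M" "Y \<in> borel_measurable M"
    using assms by (auto simp: L2_def)
  show "(\<lambda>\<omega>. inner (Y \<omega>) h *\<^sub>R X \<omega>) \<in> borel_measurable M" by measurable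
qed

text \<open>Replacing \<open>Y\<close> by \<open>P n Y\<close> turns the integral into a finite sum
  of scalar correlations, all zero. Dominated convergence then removes the truncation.\<close>

lemma L2_uncorrelated_imp_orthogonal:
  fixes X Y :: "'w \<Rightarrow> 'g::{real_inner,banach,second_countable_topology}"
  assumes X: "L2 M X" and Y: "L2 M Y"
    and uncorr: "\<And>g g'. (\<integral>\<omega>. inner (X \<omega>) g * inner (Y \<omega>) g' \<partial>M) = 0"
  shows "(\<integral>\<omega>. inner (X \<omega>) (Y \<omega>) \<partial>M) = 0"
proof -
  have [measurable]: "X \<in> borel_measurable M" "Y \<in> borel_measurable M"
    using X Y by (auto simp: L2_def)
  obtain P :: "nat \<Rightarrow> 'g \<Rightarrow> 'g" and C e where P: "\<And>n. finite (C n)"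
    "\<And>n x. P n x = (\<Sum>b\<in>C n. inner x b *\<^sub>R e b)"
    "\<And>n x. norm (P n x) \<le> norm x" "\<And>x. (\<lambda>n. P n x) \<longlonglongrightarrow> x"
    by (rule finite_rank_approximate_identity) blast
  have prod: "integrable M (\<lambda>\<omega>. inner (Y \<omega>) b * inner (X \<omega>) g)" for b g
    using integrable_inner_left[OF L2_integrable_inner_scaleR[OF X Y, of b], of g] by simp
  have "(\<integral>\<omega>. inner (X \<omega>) (P n (Y \<omega>)) \<partial>M) = 0" for n
  proof -
    have "(\<integral>\<omega>. inner (X \<omega>) (P n (Y \<omega>)) \<partial>M) = (\<integral>\<omega>. (\<Sum>b\<in>C n. inner (Y \<omega>) b * inner (X \<omega>) (e b)) \<partial>M)"
      by (simp add: P(2) inner_sum_right)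
    also have "\<dots> = (\<Sum>b\<in>C n. \<integral>\<omega>. inner (Y \<omega>) b * inner (X \<omega>) (e b) \<partial>M)"
      by (intro Bochner_Integration.integral_sum prod)
    also have "\<dots> = 0" using uncorr by (simp add: mult.commute[of "inner (Y _) _"])
    finally show ?thesis .
  qed
  moreover have "(\<lambda>n. \<integral>\<omega>. inner (X \<omega>) (P n (Y \<omega>)) \<partial>M) \<longlonglongrightarrow> (\<integral>\<omega>. inner (X \<omega>) (Y \<omega>) \<partial>M)"
  proof (rule integral_dominated_convergence)
    show "integrable M (\<lambda>\<omega>. (norm (X \<omega>))\<^sup>2 + (norm (Y \<omega>))\<^sup>2)" using X Y by (simp add: L2_def)
    show "AE \<omega> in M. (\<lambda>n. inner (X \<omega>) (P n (Y \<omega>))) \<longlonglongrightarrow> inner (X \<omega>) (Y \<omega>)"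
      by (intro AE_I2 tendsto_intros P)
    show "AE \<omega> in M. norm (inner (X \<omega>) (P n (Y \<omega>))) \<le> (norm (X \<omega>))\<^sup>2 + (norm (Y \<omega>))\<^sup>2" for n
    proof (rule AE_I2)
      fix \<omega>
      have "norm (inner (X \<omega>) (P n (Y \<omega>))) \<le> norm (X \<omega>) * norm (P n (Y \<omega>))"
        by (simp add: Cauchy_Schwarz_ineq2)
      also have "\<dots> \<le> norm (X \<omega>) * norm (Y \<omega>)" by (intro mult_left_mono P) auto
      also have "\<dots> \<le> (norm (X \<omega>))\<^sup>2 + (norm (Y \<omega>))\<^sup>2" by (rule norm_mult_le_sum_squares)
      finally show "norm (inner (X \<omega>) (P n (Y \<omega>))) \<le> (norm (X \<omega>))\<^sup>2 + (norm (Y \<omega>))\<^sup>2" .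
    qed
    show "(\<lambda>\<omega>. inner (X \<omega>) (P n (Y \<omega>))) \<in> borel_measurable M" for n
      unfolding P(2) by measurable
  qed simp
  ultimately show ?thesis by (simp add: LIMSEQ_const_iff)
qed

section \<open>Linear conditional expectation\<close>

context prob_space
begin

lemma L2_centered: "L2 M X \<Longrightarrow> L2 M (\<lambda>\<omega>. X \<omega> - bmean M X)"
  by (intro L2_diff L2_const)

lemma integral_centered: "L2 M X \<Longrightarrow> (\<integral>\<omega>. X \<omega> - bmean M X \<partial>M) = 0"
  by (simp add: bmean_def L2_imp_integrable prob_space)

text \<open>The inner product passes through the Bochner integral. This weak form is invariant under
  exchanging \<open>X, g\<close> with \<open>Y, h\<close>, whence the symmetry of \<open>C_V\<close>
  and the adjointness of \<open>C_VU\<close> and \<open>C_UV\<close>.\<close>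

lemma inner_cov:
  assumes "L2 M X" "L2 M Y"
  shows "inner (cov M X Y h) g =
    (\<integral>\<omega>. inner (Y \<omega> - bmean M Y) h * inner (X \<omega> - bmean M X) g \<partial>M)"
  using integral_inner_left[OF L2_integrable_inner_scaleR[OF assms[THEN L2_centered], of h], of g]
  by (simp add: cov_def)

lemma linear_cov:
  assumes "L2 M X" "L2 M Y" shows "linear (cov M X Y)"
proof (rule linearI)
  note int = L2_integrable_inner_scaleR[OF assms[THEN L2_centered]]
  show "cov M X Y (a + b) = cov M X Y a + cov M X Y b" for a b
    using int by (simp add: cov_def inner_add_right scaleR_add_left)
  show "cov M X Y (r *\<^sub>R a) = r *\<^sub>R cov M X Y a" for r a
    by (simp add: cov_def flip: scaleR_scaleR)
qed

lemma L2_affine: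
  assumes "\<gamma> \<in> affine_maps" "L2 M V" shows "L2 M (\<lambda>\<omega>. \<gamma> (V \<omega>))"
proof -
  obtain b A where \<gamma>: "\<gamma> = (\<lambda>h. b + A h)" "bounded_linear A"
    using assms(1) by (auto simp: affine_maps_def)
  have "L2 M (\<lambda>\<omega>. A (V \<omega>) - (- b))"
    by (rule L2_diff[OF L2_bounded_linear[OF \<gamma>(2) assms(2)] L2_const])
  then show ?thesis by (simp add: \<gamma> add.commute)
qed

text \<open>Here \<open>B\<close> is the adjoint of \<open>Q\<close>. An affine function of
  \<open>V\<close> splits into a constant and a linear function of the centered \<open>V\<close>:
  the residual has mean zero, which handles the constant, and the normal equation handles the linear
  part.\<close>

lemma residual_orthogonal_affine:
  fixes U :: "'a \<Rightarrow> 'g::{real_inner,banach,second_countable_topology}"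
    and V :: "'a \<Rightarrow> 'h::{real_inner,banach,second_countable_topology}"
  assumes U: "L2 M U" and V: "L2 M V" and B: "bounded_linear B"
    and adj: "\<And>g h. inner (Q g) h = inner g (B h)"
    and normal_eq: "\<And>g. cov M V V (Q g) = cov M V U g"
    and \<gamma>: "\<gamma> \<in> affine_maps"
  shows "(\<integral>\<omega>. inner (U \<omega> - (bmean M U + B (V \<omega> - bmean M V))) (\<gamma> (V \<omega>)) \<partial>M) = 0"
proof -
  define Uc where "Uc \<omega> = U \<omega> - bmean M U" for \<omega>
  define Vc where "Vc \<omega> = V \<omega> - bmean M V" for \<omega>
  define R where "R \<omega> = Uc \<omega> - B (Vc \<omega>)" for \<omega>
  have L2: "L2 M Uc" "L2 M Vc"
    unfolding Uc_def[abs_def] Vc_def[abs_def] using U V by (auto intro: L2_centered)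
  have LR: "L2 M R" unfolding R_def[abs_def] by (rule L2_diff[OF L2(1) L2_bounded_linear[OF B L2(2)]])
  obtain b T where bT: "\<gamma> = (\<lambda>h. b + T h)" "bounded_linear T"
    using \<gamma> by (auto simp: affine_maps_def)
  interpret T: bounded_linear T by fact
  have prod: "integrable M (\<lambda>\<omega>. inner (X \<omega>) g * inner (Vc \<omega>) h)"
    if "L2 M X" for X :: "'a \<Rightarrow> 'c::{real_inner,banach,second_countable_topology}" and g h
    using integrable_inner_left[OF L2_integrable_inner_scaleR[OF L2(2) that, of g], of h] by simp
  have BQ: "inner (B h) g = inner h (Q g)" for g h
    using adj[of g h] by (simp add: inner_commute)
  have uncorr: "(\<integral>\<omega>. inner (R \<omega>) g * inner (Vc \<omega>) h \<partial>M) = 0" for g h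
  proof -
    have "(\<integral>\<omega>. inner (R \<omega>) g * inner (Vc \<omega>) h \<partial>M) =
        (\<integral>\<omega>. inner (Uc \<omega>) g * inner (Vc \<omega>) h - inner (Vc \<omega>) (Q g) * inner (Vc \<omega>) h \<partial>M)"
      by (simp add: R_def inner_diff_left left_diff_distrib BQ)
    also have "\<dots> = inner (cov M V U g) h - inner (cov M V V (Q g)) h"
      using L2 by (simp add: Bochner_Integration.integral_diff prod inner_cov[OF V U] inner_cov[OF V V]
          flip: Uc_def Vc_def)
    finally show ?thesis by (simp add: normal_eq)
  qed
  have LT: "L2 M (\<lambda>\<omega>. T (Vc \<omega>))" by (rule L2_bounded_linear[OF bT(2) L2(2)])
  have linear_part: "(\<integral>\<omega>. inner (R \<omega>) (T (Vc \<omega>)) \<partial>M) = 0"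
  proof (rule L2_uncorrelated_imp_orthogonal[OF LR LT])
    show "(\<integral>\<omega>. inner (R \<omega>) g * inner (T (Vc \<omega>)) g' \<partial>M) = 0" for g g'
      \<comment> \<open>Testing \<open>T (Vc \<omega>)\<close> against \<open>g'\<close> is testing
        \<open>Vc \<omega>\<close> against the adjoint of \<open>T\<close> at
        \<open>g'\<close>.\<close>
      by (simp add: adjoint_op_bounded_linear(2)[OF bT(2)] uncorr)
  qed
  have "(\<integral>\<omega>. R \<omega> \<partial>M) = (\<integral>\<omega>. Uc \<omega> \<partial>M) - B (\<integral>\<omega>. Vc \<omega> \<partial>M)"
    unfolding R_def using L2 L2_bounded_linear[OF B L2(2)]
    by (simp add: L2_imp_integrable integral_bounded_linear[OF B])
  also have "\<dots> = 0"
    unfolding Uc_def Vc_def using U V by (simp add: integral_centered linear_simps(3)[OF B])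
  finally have "(\<integral>\<omega>. inner (R \<omega>) (b + T (bmean M V)) \<partial>M) = 0"
    using L2_imp_integrable[OF LR] by simp
  moreover have "inner (R \<omega>) (\<gamma> (V \<omega>)) = inner (R \<omega>) (b + T (bmean M V)) + inner (R \<omega>) (T (Vc \<omega>))" for \<omega>
    by (simp add: bT Vc_def T.diff flip: inner_add_right)
  ultimately have "(\<integral>\<omega>. inner (R \<omega>) (\<gamma> (V \<omega>)) \<partial>M) = 0"
    using linear_part by (simp add: L2_integrable_inner LR LT L2_imp_integrable
        Bochner_Integration.integral_add del: integral_inner_left)
  then show ?thesis by (simp add: R_def Uc_def Vc_def diff_diff_eq)
qed

text \<open>Pythagoras: the error of \<open>\<gamma>\<close> is the residual \<open>R\<close> plus
  the difference \<open>S\<close> of two affine functions of \<open>V\<close>, to which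
  \<open>R\<close> is orthogonal.\<close>

lemma L2_orthogonal_imp_mse_le:
  assumes U: "L2 M U" and V: "L2 M V" and \<gamma>0: "\<gamma>0 \<in> affine_maps" and \<gamma>: "\<gamma> \<in> affine_maps"
    and orth: "\<And>\<gamma>. \<gamma> \<in> affine_maps \<Longrightarrow> (\<integral>\<omega>. inner (U \<omega> - \<gamma>0 (V \<omega>)) (\<gamma> (V \<omega>)) \<partial>M) = 0"
  shows "mse M U V \<gamma>0 \<le> mse M U V \<gamma>"
proof -
  define R where "R \<omega> = U \<omega> - \<gamma>0 (V \<omega>)" for \<omega>
  define S where "S \<omega> = \<gamma>0 (V \<omega>) - \<gamma> (V \<omega>)" for \<omega>
  note L = L2_affine[OF \<gamma>0 V] L2_affine[OF \<gamma> V]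
  have LR: "L2 M R" and LS: "L2 M S"
    unfolding R_def[abs_def] S_def[abs_def] using U L by (auto intro: L2_diff)
  have int: "integrable M (\<lambda>\<omega>. (norm (R \<omega>))\<^sup>2)" "integrable M (\<lambda>\<omega>. (norm (S \<omega>))\<^sup>2)"
    using LR LS by (auto simp: L2_def)
  have "(\<integral>\<omega>. inner (R \<omega>) (S \<omega>) \<partial>M) = 0"
    using orth[OF \<gamma>0] orth[OF \<gamma>] L2_integrable_inner[OF LR L(1)] L2_integrable_inner[OF LR L(2)]
    by (simp add: S_def R_def inner_diff_right)
  moreover have eq: "(norm (U \<omega> - \<gamma> (V \<omega>)))\<^sup>2 = (norm (R \<omega>))\<^sup>2 + 2 * inner (R \<omega>) (S \<omega>) + (norm (S \<omega>))\<^sup>2" for \<omega>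
  proof -
    have "U \<omega> - \<gamma> (V \<omega>) = R \<omega> + S \<omega>" by (simp add: R_def S_def)
    then show ?thesis
      by (simp only: power2_norm_eq_inner inner_add inner_commute[of "S \<omega>" "R \<omega>"])
  qed
  ultimately have "(\<integral>\<omega>. (norm (U \<omega> - \<gamma> (V \<omega>)))\<^sup>2 \<partial>M) = (\<integral>\<omega>. (norm (R \<omega>))\<^sup>2 \<partial>M) + (\<integral>\<omega>. (norm (S \<omega>))\<^sup>2 \<partial>M)"
    using int L2_integrable_inner[OF LR LS] by simp
  then have "(\<integral>\<omega>. (norm (R \<omega>))\<^sup>2 \<partial>M) \<le> (\<integral>\<omega>. (norm (U \<omega> - \<gamma> (V \<omega>)))\<^sup>2 \<partial>M)"
    by simp
  moreover have "integrable M (\<lambda>\<omega>. (norm (U \<omega> - \<gamma> (V \<omega>)))\<^sup>2)"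
    using L2_diff[OF U L(2)] by (simp add: L2_def)
  ultimately show ?thesis
    using int(1) by (simp add: mse_def nn_integral_eq_integral ennreal_leI flip: R_def)
qed

text \<open>\<open>Z\<close> may be replaced by its approximation error \<open>W\<close>, whose
  squared norm is below \<open>t\<^sup>2\<close>. A Young inequality with weight \<open>t\<close>
  then plays the role of Cauchy-Schwarz in L2 and gives a bound that vanishes with
  \<open>t\<close>.\<close>

lemma L2_orthogonal_affine_closure:
  assumes V: "L2 M V" and R: "L2 M R" and Z: "Z \<in> affine_L2_closure M V"
    and orth: "\<And>\<gamma>. \<gamma> \<in> affine_maps \<Longrightarrow> (\<integral>\<omega>. inner (R \<omega>) (\<gamma> (V \<omega>)) \<partial>M) = 0"
  shows "(\<integral>\<omega>. inner (R \<omega>) (Z \<omega>) \<partial>M) = 0"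
proof -
  have LZ: "L2 M Z" using Z by (simp add: affine_L2_closure_def)
  define r where "r = (\<integral>\<omega>. (norm (R \<omega>))\<^sup>2 \<partial>M)"
  have r0: "r \<ge> 0" unfolding r_def by simp
  have bound: "\<bar>\<integral>\<omega>. inner (R \<omega>) (Z \<omega>) \<partial>M\<bar> \<le> t * r + t" if t: "t > 0" for t
  proof -
    have "t\<^sup>2 > 0" using t by simp
    then obtain \<gamma> where \<gamma>: "\<gamma> \<in> affine_maps"
      and lt: "(\<integral>\<^sup>+ \<omega>. ennreal ((norm (Z \<omega> - \<gamma> (V \<omega>)))\<^sup>2) \<partial>M) < ennreal (t\<^sup>2)"
      using Z unfolding affine_L2_closure_def by blast
    define W where "W \<omega> = Z \<omega> - \<gamma> (V \<omega>)" for \<omega>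
    have L\<gamma>: "L2 M (\<lambda>\<omega>. \<gamma> (V \<omega>))" by (rule L2_affine[OF \<gamma> V])
    have LW: "L2 M W" unfolding W_def[abs_def] by (rule L2_diff[OF LZ L\<gamma>])
    have int: "integrable M (\<lambda>\<omega>. (norm (R \<omega>))\<^sup>2)" "integrable M (\<lambda>\<omega>. (norm (W \<omega>))\<^sup>2)"
      using R LW by (auto simp: L2_def)
    have W: "(\<integral>\<omega>. (norm (W \<omega>))\<^sup>2 \<partial>M) < t\<^sup>2"
      using lt int(2) by (simp add: nn_integral_eq_integral ennreal_less_iff flip: W_def)
    have "(\<integral>\<omega>. inner (R \<omega>) (Z \<omega>) \<partial>M) = (\<integral>\<omega>. inner (R \<omega>) (W \<omega>) \<partial>M)"
      using orth[OF \<gamma>] L2_integrable_inner[OF R LZ] L2_integrable_inner[OF R L\<gamma>]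
      by (simp add: W_def inner_diff_right)
    also have "\<bar>\<dots>\<bar> \<le> (\<integral>\<omega>. \<bar>inner (R \<omega>) (W \<omega>)\<bar> \<partial>M)"
      by (rule integral_abs_bound)
    also have "\<dots> \<le> (\<integral>\<omega>. t * (norm (R \<omega>))\<^sup>2 + (norm (W \<omega>))\<^sup>2 / t \<partial>M)"
    proof (rule integral_mono)
      fix \<omega>
      \<comment> \<open>The two added squares turn the expansion into Young's inequality without the
        factor one half.\<close>
      have "0 \<le> (t * norm (R \<omega>) - norm (W \<omega>))\<^sup>2 + (t * norm (R \<omega>))\<^sup>2 + (norm (W \<omega>))\<^sup>2" by simp
      then have "t * (norm (R \<omega>) * norm (W \<omega>)) \<le> t * (t * (norm (R \<omega>))\<^sup>2 + (norm (W \<omega>))\<^sup>2 / t)"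
        using t by (simp add: power2_diff power_mult_distrib distrib_left power2_eq_square algebra_simps)
      then have "norm (R \<omega>) * norm (W \<omega>) \<le> t * (norm (R \<omega>))\<^sup>2 + (norm (W \<omega>))\<^sup>2 / t"
        using t by (simp add: mult_le_cancel_left_pos)
      then show "\<bar>inner (R \<omega>) (W \<omega>)\<bar> \<le> t * (norm (R \<omega>))\<^sup>2 + (norm (W \<omega>))\<^sup>2 / t"
        using Cauchy_Schwarz_ineq2 order_trans by blast
    qed (use int L2_integrable_inner[OF R LW] in auto)
    also have "\<dots> = t * r + (\<integral>\<omega>. (norm (W \<omega>))\<^sup>2 \<partial>M) / t"
      using int by (simp add: r_def)
    also have "\<dots> \<le> t * r + t"
      using W t by (simp add: divide_le_eq power2_eq_square)
    finally show ?thesis .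
  qed
  have "\<bar>\<integral>\<omega>. inner (R \<omega>) (Z \<omega>) \<partial>M\<bar> \<le> 0"
  proof (rule field_le_epsilon)
    fix e :: real assume "e > 0"
    then have "e / (r + 1) > 0" using r0 by simp
    moreover have "e / (r + 1) * r + e / (r + 1) = e"
      using r0 by (simp add: add_nonneg_eq_0_iff flip: distrib_left add_divide_distrib) (simp add: field_simps)
    ultimately show "\<bar>\<integral>\<omega>. inner (R \<omega>) (Z \<omega>) \<partial>M\<bar> \<le> 0 + e"
      using bound[of "e / (r + 1)"] by simp
  qed
  then show ?thesis by simp
qed

lemma affine_in_affine_L2_closure:
  assumes "L2 M V" "\<gamma> \<in> affine_maps"
  shows "(\<lambda>\<omega>. \<gamma> (V \<omega>)) \<in> affine_L2_closure M V"
  using assms by (auto simp: affine_L2_closure_def L2_affine intro!: bexI[of _ \<gamma>])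

end

text \<open>The squared distance of two projections is a difference of two residuals paired with
  \<open>W - W'\<close>. Each pairing vanishes on testing against \<open>W\<close> and
  \<open>W'\<close> separately, so \<open>S\<close> need not be checked for closure under
  differences.\<close>

lemma is_L2_proj_unique:
  assumes U: "L2 M U" and S: "\<And>W. W \<in> S \<Longrightarrow> L2 M W"
    and W: "is_L2_proj M S U W" and W': "is_L2_proj M S U W'"
  shows "AE \<omega> in M. W \<omega> = W' \<omega>"
proof -
  have mem: "W \<in> S" "W' \<in> S" using W W' by (auto simp: is_L2_proj_def)
  then have L: "L2 M W" "L2 M W'" using S by auto
  have LD: "L2 M (\<lambda>\<omega>. W \<omega> - W' \<omega>)" by (intro L2_diff L)
  have orth: "(\<integral>\<omega>. inner (U \<omega> - X \<omega>) (W \<omega> - W' \<omega>) \<partial>M) = 0" if "is_L2_proj M S U X" for X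
  proof -
    have "X \<in> S" using that by (simp add: is_L2_proj_def)
    then have LX: "L2 M (\<lambda>\<omega>. U \<omega> - X \<omega>)" by (intro L2_diff U S)
    show ?thesis
      using that mem L2_integrable_inner[OF LX L(1)] L2_integrable_inner[OF LX L(2)]
      by (simp add: is_L2_proj_def inner_diff_right)
  qed
  have "(\<integral>\<omega>. (norm (W \<omega> - W' \<omega>))\<^sup>2 \<partial>M) =
      (\<integral>\<omega>. inner (U \<omega> - W' \<omega>) (W \<omega> - W' \<omega>) - inner (U \<omega> - W \<omega>) (W \<omega> - W' \<omega>) \<partial>M)"
    by (simp add: power2_norm_eq_inner flip: inner_diff_left)
  also have "\<dots> = 0"
    using orth[OF W] orth[OF W'] L2_integrable_inner[OF L2_diff[OF U L(1)] LD]
      L2_integrable_inner[OF L2_diff[OF U L(2)] LD] by simp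
  finally have "AE \<omega> in M. (norm (W \<omega> - W' \<omega>))\<^sup>2 = 0"
    using LD by (subst (asm) integral_nonneg_eq_0_iff_AE) (auto simp: L2_def)
  then show ?thesis by simp
qed

theorem mainTheorem8:
  fixes M :: "'w measure"
    and U :: "'w \<Rightarrow> 'g::{real_inner,banach,second_countable_topology}"
    and V :: "'w \<Rightarrow> 'h::{real_inner,banach,second_countable_topology}"
  assumes "prob_space M"
    and "L2 M U" and "L2 M V"
    and "range (cov M V U) \<subseteq> range (cov M V V)"
  shows "(\<forall>g. cov M V U g \<in> pinv_dom (cov M V V))
     \<and> bounded_linear (\<lambda>g. pinv (cov M V V) (cov M V U g))
     \<and> (let \<gamma>A = (\<lambda>v. bmean M U + adjoint_op (\<lambda>g. pinv (cov M V V) (cov M V U g)) (v - bmean M V))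
        in \<gamma>A \<in> affine_maps
           \<and> (\<forall>\<gamma>\<in>affine_maps. mse M U V \<gamma>A \<le> mse M U V \<gamma>)
           \<and> is_L2_proj M (affine_L2_closure M V) U (\<lambda>\<omega>. \<gamma>A (V \<omega>))
           \<and> (\<forall>W. is_L2_proj M (affine_L2_closure M V) U W \<longrightarrow> (AE \<omega> in M. W \<omega> = \<gamma>A (V \<omega>))))"
proof -
  interpret prob_space M by fact
  note U = \<open>L2 M U\<close> and V = \<open>L2 M V\<close>
  have ran: "cov M V U g \<in> range (cov M V V)" for g
    using assms(4) by blast
  have symm: "inner (cov M V V x) y = inner x (cov M V V y)" for x y
    using inner_cov[OF V V, of x y] inner_cov[OF V V, of y x] by (simp add: mult.commute inner_commute)
  \<comment> \<open>\<open>cov M U V\<close> serves as the map \<open>D\<close> in the boundedness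
    lemma for the pseudo-inverse.\<close>
  have adj: "inner (cov M V U g) h = inner g (cov M U V h)" for g h
    using inner_cov[OF V U, of g h] inner_cov[OF U V, of h g] by (simp add: mult.commute inner_commute)
  note lin = linear_cov[OF V V]
  define Q where "Q g = pinv (cov M V V) (cov M V U g)" for g
  have "closed (cov M V V -` {0})"
    using orth_compl_range_symmetric[of "cov M V V"] symm closed_orth_compl by metis
  \<comment> \<open>The normal equation: with a closed kernel, the range inclusion makes the
    pseudo-inverse a genuine right inverse on these values.\<close>
  then have CQ: "cov M V V (Q g) = cov M V U g" for g
    unfolding Q_def using pinv_range(2)[OF lin _ ran] by blast
  have Q: "bounded_linear Q"
    unfolding Q_def[abs_def]
    using bounded_linear_pinv_comp[OF lin symm linear_cov[OF V U] adj assms(4)] .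
  define B where "B = adjoint_op Q"
  have B: "bounded_linear B" and QB: "inner (Q g) h = inner g (B h)" for g h
    unfolding B_def using adjoint_op_bounded_linear[OF Q] by auto
  define \<gamma>A where "\<gamma>A v = bmean M U + B (v - bmean M V)" for v
  \<comment> \<open>The centering is absorbed into the constant term, to match the form required by
    \<open>affine_maps\<close>.\<close>
  have "\<gamma>A = (\<lambda>v. (bmean M U - B (bmean M V)) + B v)"
    by (auto simp: \<gamma>A_def linear_simps(2)[OF B])
  then have aff: "\<gamma>A \<in> affine_maps" using B by (auto simp: affine_maps_def)
  have orth: "(\<integral>\<omega>. inner (U \<omega> - \<gamma>A (V \<omega>)) (\<gamma> (V \<omega>)) \<partial>M) = 0" if "\<gamma> \<in> affine_maps" for \<gamma>
    unfolding \<gamma>A_def by (rule residual_orthogonal_affine[OF U V B QB CQ that])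
  have proj: "is_L2_proj M (affine_L2_closure M V) U (\<lambda>\<omega>. \<gamma>A (V \<omega>))"
    unfolding is_L2_proj_def
    using L2_orthogonal_affine_closure[OF V L2_diff[OF U L2_affine[OF aff V]] _ orth]
      affine_in_affine_L2_closure[OF V aff] by blast
  have "cov M V U g \<in> pinv_dom (cov M V V)" for g
    using ran[of g] by (force simp: pinv_dom_def orth_compl_def)
  moreover have "mse M U V \<gamma>A \<le> mse M U V \<gamma>" if "\<gamma> \<in> affine_maps" for \<gamma>
    using U V aff that orth by (rule L2_orthogonal_imp_mse_le)
  moreover have "AE \<omega> in M. W \<omega> = \<gamma>A (V \<omega>)" if "is_L2_proj M (affine_L2_closure M V) U W" for W
    using is_L2_proj_unique[OF U _ that proj] by (simp add: affine_L2_closure_def)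
  ultimately show ?thesis
    using Q aff proj unfolding Let_def Q_def[abs_def] B_def \<gamma>A_def[abs_def] by blast
qed

end
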